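(* Let $C$ be a class of formulas. Let $\mathcal{A}$ be an exact concept learning algorithm that can identify every $\varphi\in C$ in at most $s_1$ equivalence queries and $s_2$ membership queries. Assume further that, with $\varphi$ denoting the target formula, whenever $\mathcal{A}$ performs an equivalence query on $\theta$ it always holds that $\theta\Longrightarrow\varphi$, and whenever $\mathcal{A}$ performs a membership query on $\sigma$ it always holds that $\sigma\models\varphi$ or $\sigma\in\partial^-(\varphi)$. Then there exists an invariant inference algorithm that is sound (returns only correct inductive invariants) and, furthermore, can find an inductive invariant for every transition system that admits an inductive invariant $I\in C$ that is backwards $k$-fenced, using at most $s_1+1$ inductiveness checks and $s_2$ $k$-BMC checks.
   Context: Transition systems. $\Sigma=\{p_1,\dots,p_n\}$ is a finite set of Boolean variables; a state is a valuation of $\Sigma$; a formula over $\Sigma$ is identified with the set of states satisfying it, and $\varphi\Longrightarrow\psi$ means that $\varphi\to\psi$ is valid. A transition system is a triple $(\mathit{Init},\delta,\mathit{Bad})$ with $\mathit{Init},\mathit{Bad}$ formulas over $\Sigma$ and $\delta$ a formula over $\Sigma\uplus\Sigma'$ ($\Sigma'$ a primed copy), describing pairs (pre-state, post-state). Standing assumptions: $\mathit{Init}\not\equiv\mathit{false}$, $\mathit{Bad}\not\equiv\mathit{true},\mathit{false}$, $\mathit{Init}\Longrightarrow\neg\mathit{Bad}$. An inductive invariant is a formula $I$ over $\Sigma$ with (i) $\mathit{Init}\Longrightarrow I$, (ii) $I\wedge\delta\Longrightarrow I'$, (iii) $I\Longrightarrow\neg\mathit{Bad}$, where $I'$ is $I$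 with variables primed. $\delta^{\le k}(S)$ is the set of states reachable from some state in $S$ in at most $k$ steps of $\delta$; $(\delta^{-1})^{\le k}(\mathit{Bad})$ is the set of states from which some state of $\mathit{Bad}$ is reachable in at most $k$ steps. Two states are neighbors if they differ in exactly one variable. For a formula $\varphi$, $\partial^-(\varphi)=\{\sigma\not\models\varphi : \sigma \text{ has a neighbor } \models\varphi\}$. An inductive invariant $I$ is backwards $k$-fenced if $\partial^-(I)\subseteq(\delta^{-1})^{\le k}(\mathit{Bad})$. Exact concept learning. A learner must identify an unknown target formula $\varphi$ (up to equivalence) by adaptively posing queries to a teacher: a membership query on a state $\sigma$, answered by whether $\sigma\models\varphi$; an equivalence query on a formula $\theta$, answered by "true" if $\theta\equiv\varphi$ and otherwise by some (arbitrary) state $\sigma$ on which $\theta$ and $\varphi$ differ. An invariant inference algorithm receives a transition system (and the bound $k$) but not $I$; it may perform inductiveness checks (deciding whether a candidate is an inductive invariant, and obtaining a counterexample to one of (i)–(iii) if not; a counterexample to (ii) is a pair $(\sigma,\sigma')$) and $k$-BMC checks (deciding whether $\delta^{\le k}(\psi)\cap\mathit{Bad}=\emptyset$ or whether $\delta^{\le k}(\mathit{Init})\cap\psi=\emptyset$ for a given $\psi$), and either returns a formula or reports failure. *)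

theory Defs
  imports Main
begin

text \<open>
  The variables $\Sigma$ are the elements of a type \<open>'v\<close> (of class \<open>finite\<close> in the theorem).
  Formulas are identified with their sets of models, so \<open>\<Longrightarrow>\<close> between formulas is \<open>\<subseteq>\<close>
  and equivalence is \<open>=\<close>. A formula over $\Sigma \uplus \Sigma'$ is a relation between pre- and
  post-states.
\<close>

type_synonym 'v state = "'v \<Rightarrow> bool"
type_synonym 'v formula = "'v state set"

record 'v ts =
  Init :: "'v formula"
  Trans :: "('v state \<times> 'v state) set"
  Bad :: "'v formula"

definition transition_system :: "'v ts \<Rightarrow> bool" where
  "transition_system T \<longleftrightarrow>
     Init T \<noteq> {} \<and> Bad T \<noteq> UNIV \<and> Bad T \<noteq> {} \<and> Init T \<subseteq> - Bad T"

definition inductive_invariant :: "'v ts \<Rightarrow> 'v formula \<Rightarrow> bool" where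
  "inductive_invariant T I \<longleftrightarrow>
     Init T \<subseteq> I \<and>
     (\<forall>\<sigma> \<sigma>'. \<sigma> \<in> I \<and> (\<sigma>, \<sigma>') \<in> Trans T \<longrightarrow> \<sigma>' \<in> I) \<and>
     I \<subseteq> - Bad T"

definition reach_within :: "('a \<times> 'a) set \<Rightarrow> nat \<Rightarrow> 'a set \<Rightarrow> 'a set" where
  "reach_within R k S = (\<Union>i\<le>k. (R ^^ i) `` S)"

definition neighbors :: "'v state \<Rightarrow> 'v state \<Rightarrow> bool" where
  "neighbors \<sigma> \<tau> \<longleftrightarrow> (\<exists>!p. \<sigma> p \<noteq> \<tau> p)"

definition outer_boundary :: "'v formula \<Rightarrow> 'v formula" where
  "outer_boundary \<phi> = {\<sigma>. \<sigma> \<notin> \<phi> \<and> (\<exists>\<tau>. neighbors \<sigma> \<tau> \<and> \<tau> \<in> \<phi>)}"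

definition backwards_fenced :: "'v ts \<Rightarrow> nat \<Rightarrow> 'v formula \<Rightarrow> bool" where
  "backwards_fenced T k I \<longleftrightarrow> outer_boundary I \<subseteq> reach_within ((Trans T)\<inverse>) k (Bad T)"

text \<open>
  A concept learning algorithm is the tree of its interactions with a teacher: at each node it
  outputs a formula or poses a query and continues depending on the answer. The answer \<open>None\<close> to
  an equivalence query means ``true''. The trees are coinductive because nothing is assumed about
  termination when the target lies outside the class to be learned.
\<close>

codatatype 'v learner =
    Output "'v formula"
  | Member "'v state" "bool \<Rightarrow> 'v learner"
  | Equiv "'v formula" "'v state option \<Rightarrow> 'v learner"

text \<open>
  \<open>learner_run \<phi> A e m B\<close>: for target \<open>\<phi>\<close>, some correct teacher can lead \<open>A\<close> to the node \<open>B\<close>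
  with \<open>e\<close> equivalence and \<open>m\<close> membership queries answered. The query posed at \<open>B\<close> itself, if any,
  is not counted.
\<close>

inductive learner_run :: "'v formula \<Rightarrow> 'v learner \<Rightarrow> nat \<Rightarrow> nat \<Rightarrow> 'v learner \<Rightarrow> bool"
  for \<phi> :: "'v formula" and A :: "'v learner" where
  start: "learner_run \<phi> A 0 0 A"
| member: "learner_run \<phi> A e m (Member \<sigma> c) \<Longrightarrow> learner_run \<phi> A e (Suc m) (c (\<sigma> \<in> \<phi>))"
| equiv_true: "learner_run \<phi> A e m (Equiv \<theta> c) \<Longrightarrow> \<theta> = \<phi> \<Longrightarrow> learner_run \<phi> A (Suc e) m (c None)"
| equiv_false: "learner_run \<phi> A e m (Equiv \<theta> c) \<Longrightarrow> (\<sigma> \<in> \<theta>) \<noteq> (\<sigma> \<in> \<phi>) \<Longrightarrow>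
    learner_run \<phi> A (Suc e) m (c (Some \<sigma>))"

text \<open>
  Runs may stop at any node, and a run at a query node can always be extended. Bounding the number
  of queries in all runs therefore forces every maximal run to end in an \<open>Output\<close> node.
\<close>

definition identifies :: "'v learner \<Rightarrow> 'v formula \<Rightarrow> nat \<Rightarrow> nat \<Rightarrow> bool" where
  "identifies A \<phi> s1 s2 \<longleftrightarrow>
     (\<forall>e m B. learner_run \<phi> A e m B \<longrightarrow>
        e \<le> s1 \<and> m \<le> s2 \<and> (\<forall>\<psi>. B = Output \<psi> \<longrightarrow> \<psi> = \<phi>))"

datatype 'v check_answer =
    Inductive
  | Cex_Init "'v state"
  | Cex_Step "'v state" "'v state"
  | Cex_Bad "'v state"

fun check_answer_ok :: "'v ts \<Rightarrow> 'v formula \<Rightarrow> 'v check_answer \<Rightarrow> bool" where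
  "check_answer_ok T \<theta> Inductive \<longleftrightarrow> inductive_invariant T \<theta>"
| "check_answer_ok T \<theta> (Cex_Init \<sigma>) \<longleftrightarrow> \<sigma> \<in> Init T \<and> \<sigma> \<notin> \<theta>"
| "check_answer_ok T \<theta> (Cex_Step \<sigma> \<sigma>') \<longleftrightarrow> \<sigma> \<in> \<theta> \<and> (\<sigma>, \<sigma>') \<in> Trans T \<and> \<sigma>' \<notin> \<theta>"
| "check_answer_ok T \<theta> (Cex_Bad \<sigma>) \<longleftrightarrow> \<sigma> \<in> \<theta> \<and> \<sigma> \<in> Bad T"

text \<open>
  An inference algorithm is likewise an interaction tree; it has access to the transition system
  only through its checks. Without this restriction a bound on the number of checks would be
  meaningless: over finitely many states, an algorithm free to inspect the system needs no checks.
  The trees are well-founded, so an inference algorithm ends in \<open>Return\<close> or \<open>Failure\<close> on every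
  transition system.
\<close>

datatype 'v inference =
    Return "'v formula"
  | Failure
  | Check "'v formula" "'v check_answer \<Rightarrow> 'v inference"
  | BMC_Bad "'v formula" "bool \<Rightarrow> 'v inference"
  | BMC_Init "'v formula" "bool \<Rightarrow> 'v inference"

text \<open>
  \<open>inference_run T k M i b N\<close>: on \<open>T\<close>, the algorithm \<open>M\<close> can get to the node \<open>N\<close> with \<open>i\<close>
  inductiveness checks and \<open>b\<close> \<open>k\<close>-BMC checks answered. The choice of a counterexample is
  arbitrary.
\<close>

inductive inference_run ::
  "'v ts \<Rightarrow> nat \<Rightarrow> 'v inference \<Rightarrow> nat \<Rightarrow> nat \<Rightarrow> 'v inference \<Rightarrow> bool"
  for T :: "'v ts" and k :: nat and M :: "'v inference" where
  start: "inference_run T k M 0 0 M"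
| check: "inference_run T k M i b (Check \<theta> c) \<Longrightarrow> check_answer_ok T \<theta> a \<Longrightarrow>
    inference_run T k M (Suc i) b (c a)"
| bmc_bad: "inference_run T k M i b (BMC_Bad \<psi> c) \<Longrightarrow>
    inference_run T k M i (Suc b) (c (reach_within (Trans T) k \<psi> \<inter> Bad T = {}))"
| bmc_init: "inference_run T k M i b (BMC_Init \<psi> c) \<Longrightarrow>
    inference_run T k M i (Suc b) (c (reach_within (Trans T) k (Init T) \<inter> \<psi> = {}))"

text \<open>The argument of \<open>M\<close> in \<open>sound\<close> is the bound \<open>k\<close>, which the algorithm receives as input.\<close>

definition sound :: "(nat \<Rightarrow> 'v inference) \<Rightarrow> bool" where
  "sound M \<longleftrightarrow>
     (\<forall>T k i b J. transition_system T \<longrightarrow> inference_run T k (M k) i b (Return J) \<longrightarrow>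
        inductive_invariant T J)"

definition finds_invariant :: "'v inference \<Rightarrow> 'v ts \<Rightarrow> nat \<Rightarrow> nat \<Rightarrow> nat \<Rightarrow> bool" where
  "finds_invariant M T k n1 n2 \<longleftrightarrow>
     (\<forall>i b N. inference_run T k M i b N \<longrightarrow>
        i \<le> n1 \<and> b \<le> n2 \<and> N \<noteq> Failure \<and> (\<forall>J. N = Return J \<longrightarrow> inductive_invariant T J))"

end

theory Submission
  imports Defs
begin

text \<open>
  Simulate the learner with a backwards \<open>k\<close>-fenced invariant \<open>I \<in> C\<close> as its target. A membership
  query \<open>\<sigma>\<close> lies in \<open>I\<close>, whose states never reach \<open>Bad\<close>, or in \<open>outer_boundary I\<close>, whose states
  reach \<open>Bad\<close> within \<open>k\<close> steps by fencing, so a BMC check of \<open>{\<sigma>}\<close> answers it. An equivalence query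
  \<open>\<theta>\<close> satisfies \<open>\<theta> \<subseteq> I\<close>, so \<open>\<theta>\<close> excludes \<open>Bad\<close>, and every counterexample to its inductiveness
  exhibits a state of \<open>I - \<theta>\<close>, a legitimate answer of the teacher. If \<open>\<theta>\<close> is inductive, it can
  be returned even if it differs from \<open>I\<close>. The additional inductiveness check validates the
  output of the learner, which secures soundness on systems without such an invariant.
\<close>

lemma relpow_converse: "((R :: 'a rel)\<inverse>) ^^ n = (R ^^ n)\<inverse>"
  by (induction n) (simp_all add: converse_relcomp flip: relpow_commute)

text \<open>Links fencing, phrased by backward reachability from \<open>Bad\<close>, with the
  forward reachability that a BMC check decides.\<close>

lemma reach_within_converse:
  "\<sigma> \<in> reach_within (R\<inverse>) k S \<longleftrightarrow> reach_within R k {\<sigma>} \<inter> S \<noteq> {}"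
  by (auto simp: reach_within_def relpow_converse)

lemma inductive_invariant_relpow:
  assumes "inductive_invariant T I" "\<sigma> \<in> I" "(\<sigma>, \<tau>) \<in> Trans T ^^ i"
  shows "\<tau> \<in> I"
  using assms(3)
proof (induction i arbitrary: \<tau>)
  case 0
  then show ?case using assms(2) by simp
next
  case (Suc i)
  then show ?case using assms(1) unfolding inductive_invariant_def by auto
qed

lemma bmc_iff_mem:
  assumes "inductive_invariant T I" "backwards_fenced T k I"
    and "\<sigma> \<in> I \<or> \<sigma> \<in> outer_boundary I"
  shows "reach_within (Trans T) k {\<sigma>} \<inter> Bad T = {} \<longleftrightarrow> \<sigma> \<in> I"
proof
  assume "reach_within (Trans T) k {\<sigma>} \<inter> Bad T = {}"
  then have "\<sigma> \<notin> reach_within ((Trans T)\<inverse>) k (Bad T)"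
    by (simp add: reach_within_converse)
  then show "\<sigma> \<in> I"
    using assms(2,3) unfolding backwards_fenced_def by blast
next
  assume "\<sigma> \<in> I"
  then have "reach_within (Trans T) k {\<sigma>} \<subseteq> I"
    using inductive_invariant_relpow[OF assms(1)] by (auto simp: reach_within_def)
  then show "reach_within (Trans T) k {\<sigma>} \<inter> Bad T = {}"
    using assms(1) unfolding inductive_invariant_def by blast
qed

text \<open>
  The first argument is fuel: learners need not be well-founded, inference algorithms are.
\<close>

primrec simulate :: "nat \<Rightarrow> 'v learner \<Rightarrow> 'v inference" where
  "simulate 0 A = Failure"
| "simulate (Suc n) A =
    (case A of
      Output \<psi> \<Rightarrow> Check \<psi> (\<lambda>a. case a of Inductive \<Rightarrow> Return \<psi> | _ \<Rightarrow> Failure)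
    | Member \<sigma> c \<Rightarrow> BMC_Bad {\<sigma>} (\<lambda>r. simulate n (c r))
    | Equiv \<theta> c \<Rightarrow> Check \<theta> (\<lambda>a. case a of
          Inductive \<Rightarrow> Return \<theta>
        | Cex_Init \<sigma> \<Rightarrow> simulate n (c (Some \<sigma>))
        | Cex_Step \<sigma> \<sigma>' \<Rightarrow> simulate n (c (Some \<sigma>'))
        | Cex_Bad \<sigma> \<Rightarrow> Failure))"

text \<open>Every \<open>Return\<close> sits behind a check, so a \<open>Return\<close> node falls
  under the second disjunct of the run invariants below.\<close>

lemma simulate_not_Return [simp]: "simulate n A \<noteq> Return J"
  by (cases n) (auto split: learner.split)

lemma simulate_eq_CheckE:
  assumes "simulate n A = Check \<theta> c"
  obtains n' where "n = Suc n'" "A = Output \<theta>"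
      "c = (\<lambda>a. case a of Inductive \<Rightarrow> Return \<theta> | _ \<Rightarrow> Failure)"
    | n' d where "n = Suc n'" "A = Equiv \<theta> d"
      "c = (\<lambda>a. case a of
          Inductive \<Rightarrow> Return \<theta>
        | Cex_Init \<sigma> \<Rightarrow> simulate n' (d (Some \<sigma>))
        | Cex_Step \<sigma> \<sigma>' \<Rightarrow> simulate n' (d (Some \<sigma>'))
        | Cex_Bad \<sigma> \<Rightarrow> Failure)"
  using assms by (cases n) (auto split: learner.splits)

lemma simulate_eq_BMC_BadE:
  assumes "simulate n A = BMC_Bad \<psi> c"
  obtains n' \<sigma> d where "n = Suc n'" "A = Member \<sigma> d" "\<psi> = {\<sigma>}" "c = (\<lambda>r. simulate n' (d r))"
  using assms by (cases n) (auto split: learner.splits)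

lemma simulate_not_BMC_Init [simp]: "simulate n A \<noteq> BMC_Init \<psi> c"
  by (cases n) (auto split: learner.split)

text \<open>A formula is returned only on the answer \<open>Inductive\<close> to a check of that
  very formula, whatever the learner does.\<close>

lemma inference_run_simulate_sound:
  assumes "inference_run T k (simulate n A) i b N"
  shows "(\<exists>n' B. N = simulate n' B) \<or> (\<exists>J. N = Return J \<and> inductive_invariant T J)"
  using assms
proof induction
  case start
  then show ?case by blast
next
  case (check i b \<theta> c a)
  \<comment> \<open>Zero fuel yields \<open>Failure\<close>, which brings failing nodes under the
    first disjunct.\<close>
  have fail: "\<exists>n' B. Failure = simulate n' B"
    by (metis simulate.simps(1))
  from check.IH obtain n' B where "simulate n' B = Check \<theta> c" by force
  then show ?case
    using check.hyps(2) fail by (cases rule: simulate_eq_CheckE) (cases a; auto)+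
next
  case (bmc_bad i b \<psi> c)
  then obtain n' B where "simulate n' B = BMC_Bad \<psi> c" by force
  then show ?case by (cases rule: simulate_eq_BMC_BadE) auto
next
  case (bmc_init i b \<psi> c)
  then show ?case using simulate_not_BMC_Init by (metis inference.distinct(8))
qed

lemma sound_simulate: "sound (\<lambda>_. simulate n A)"
  unfolding sound_def
  by (metis inference_run_simulate_sound inference.inject(1) simulate_not_Return)

lemma finds_invariant_simulate:
  assumes ident: "identifies A I s1 s2"
    and equiv: "\<And>e m \<theta> c. learner_run I A e m (Equiv \<theta> c) \<Longrightarrow> \<theta> \<subseteq> I"
    and memb: "\<And>e m \<sigma> c. learner_run I A e m (Member \<sigma> c) \<Longrightarrow> \<sigma> \<in> I \<or> \<sigma> \<in> outer_boundary I"
    and inv: "inductive_invariant T I"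
    and fenced: "backwards_fenced T k I"
  shows "finds_invariant (simulate (Suc (s1 + s2)) A) T k (s1 + 1) s2"
proof -
  have bound: "e \<le> s1" "m \<le> s2" if "learner_run I A e m B" for e m B
    using ident that unfolding identifies_def by blast+
  have out: "\<psi> = I" if "learner_run I A e m (Output \<psi>)" for e m \<psi>
    using ident that unfolding identifies_def by blast
  \<comment> \<open>Until a formula is returned, checks and learner queries match one to one, each
    costing one unit of fuel. The check that leads to \<open>Return\<close> need not extend the
    learner's run, hence \<open>s1 + 1\<close>.\<close>
  have "(\<exists>n B. learner_run I A i b B \<and> i + b + n = Suc (s1 + s2) \<and> N = simulate n B) \<or>
      (i \<le> s1 + 1 \<and> b \<le> s2 \<and> (\<exists>J. N = Return J \<and> inductive_invariant T J))"
    if "inference_run T k (simulate (Suc (s1 + s2)) A) i b N" for i b N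
    using that
  proof induction
    case start
    then show ?case by (auto intro: learner_run.start)
  next
    case (check i b \<theta> c a)
    then obtain n B where run: "learner_run I A i b B" and fuel: "i + b + n = Suc (s1 + s2)"
      and sim: "simulate n B = Check \<theta> c"
      by force
    note ib = bound[OF run]
    from sim show ?case
    proof (cases rule: simulate_eq_CheckE)
      case (1 n')
      \<comment> \<open>As \<open>I\<close> is an inductive invariant, only the answer
        \<open>Inductive\<close> is possible.\<close>
      then have "\<theta> = I" using run out by blast
      then show ?thesis
        using 1 check.hyps(2) inv ib by (cases a) (auto simp: inductive_invariant_def)
    next
      case (2 n' d)
      have sub: "\<theta> \<subseteq> I" using run equiv 2 by blast
      have step: "learner_run I A (Suc i) b (d (Some \<tau>))" if "\<tau> \<in> I" "\<tau> \<notin> \<theta>" for \<tau>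
        using learner_run.equiv_false[of I A i b \<theta> d \<tau>] run 2 that by simp
      show ?thesis
      proof (cases a)
        case Inductive
        then show ?thesis using 2 check.hyps(2) ib by simp
      next
        case (Cex_Init \<sigma>)
        then have "\<sigma> \<in> I" "\<sigma> \<notin> \<theta>"
          using check.hyps(2) inv by (auto simp: inductive_invariant_def)
        from step[OF this] show ?thesis using 2 Cex_Init fuel by force
      next
        case (Cex_Step \<sigma> \<sigma>')
        \<comment> \<open>The pre-state lies in \<open>\<theta>\<close>, hence in \<open>I\<close>,
          and \<open>I\<close> is closed under transitions; so the post-state is the one to pass
          on.\<close>
        then have "\<sigma>' \<in> I" "\<sigma>' \<notin> \<theta>"
          using check.hyps(2) inv sub by (auto simp: inductive_invariant_def)
        from step[OF this] show ?thesis using 2 Cex_Step fuel by force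
      next
        case (Cex_Bad \<sigma>)
        then show ?thesis
          using check.hyps(2) inv sub by (auto simp: inductive_invariant_def)
      qed
    qed
  next
    case (bmc_bad i b \<psi> c)
    then obtain n B where run: "learner_run I A i b B" and fuel: "i + b + n = Suc (s1 + s2)"
      and sim: "simulate n B = BMC_Bad \<psi> c"
      by force
    from sim show ?case
    proof (cases rule: simulate_eq_BMC_BadE)
      case (1 n' \<sigma> d)
      then have "reach_within (Trans T) k \<psi> \<inter> Bad T = {} \<longleftrightarrow> \<sigma> \<in> I"
        using bmc_iff_mem[OF inv fenced] memb run by blast
      moreover have "learner_run I A i (Suc b) (d (\<sigma> \<in> I))"
        using learner_run.member run 1 by blast
      ultimately show ?thesis using 1 fuel by force
    qed
  next
    case (bmc_init i b \<psi> c)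
    then show ?case by (metis simulate_not_BMC_Init inference.distinct(8))
  qed
  \<comment> \<open>At most \<open>s1 + s2\<close> queries are answered, so a unit of fuel is always
    left, enough to validate an output.\<close>
  moreover have "simulate n B \<noteq> Failure"
    if "learner_run I A i b B" "i + b + n = Suc (s1 + s2)" for i b n B
  proof -
    from bound[OF that(1)] that(2) obtain n' where "n = Suc n'" by (cases n) auto
    then show ?thesis by (simp split: learner.split)
  qed
  ultimately show ?thesis
    unfolding finds_invariant_def
    by (smt (verit) bound inference.distinct(1) le_add1 le_trans inference.inject(1) simulate_not_Return)
qed

theorem corollary7p3:
  fixes C :: "('v::finite) formula set" and A :: "'v learner" and s1 s2 :: nat
  assumes "\<And>\<phi>. \<phi> \<in> C \<Longrightarrow> identifies A \<phi> s1 s2"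
    and "\<And>\<phi> e m \<theta> c. \<phi> \<in> C \<Longrightarrow> learner_run \<phi> A e m (Equiv \<theta> c) \<Longrightarrow> \<theta> \<subseteq> \<phi>"
    and "\<And>\<phi> e m \<sigma> c. \<phi> \<in> C \<Longrightarrow> learner_run \<phi> A e m (Member \<sigma> c) \<Longrightarrow>
           \<sigma> \<in> \<phi> \<or> \<sigma> \<in> outer_boundary \<phi>"
  shows "\<exists>M :: nat \<Rightarrow> 'v inference. sound M \<and>
    (\<forall>T k. transition_system T \<longrightarrow>
       (\<exists>I\<in>C. inductive_invariant T I \<and> backwards_fenced T k I) \<longrightarrow>
       finds_invariant (M k) T k (s1 + 1) s2)"
  proof (intro exI conjI allI impI)
  \<comment> \<open>One tree serves all \<open>k\<close>: the bound enters through the answers to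
    the BMC checks.\<close>
  show "sound (\<lambda>_. simulate (Suc (s1 + s2)) A)"
    by (rule sound_simulate)
  fix T :: "'v ts" and k
  assume "\<exists>I\<in>C. inductive_invariant T I \<and> backwards_fenced T k I"
  then show "finds_invariant (simulate (Suc (s1 + s2)) A) T k (s1 + 1) s2"
    using assms finds_invariant_simulate by metis
qed

end
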